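(* Let $G$ and $H$ be simple connected graphs, each with at least two vertices. Then the strong product $G \boxtimes H$ is isomorphic to the lexicographic product $G \circ H$ if and only if $H$ is a complete graph.
   Context: All graphs are finite, undirected and simple (no loops or multiple edges). For graphs $G$ and $H$, the following products have vertex set $V(G)\times V(H)$. The strong product $G\boxtimes H$: $(x,y)\sim(x',y')$ if either ($x\sim x'$ in $G$ and $y=y'$) or ($x=x'$ and $y\sim y'$ in $H$) or ($x\sim x'$ in $G$ and $y\sim y'$ in $H$). The lexicographic product $G\circ H$: $(x,y)\sim(x',y')$ if either $x\sim x'$ in $G$, or ($x=x'$ and $y\sim y'$ in $H$). Two graphs are isomorphic if there is a bijection between their vertex sets that preserves adjacency and non-adjacency. *)

theory Defs
  imports "Graph_Theory.Kuratowski" "Graph_Theory.Digraph_Isomorphism"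
begin

text \<open>
  A finite simple undirected graph is a \<^locale>\<open>pair_graph\<close>: a finite vertex set with a symmetric,
  irreflexive set of arcs, each edge being represented by its two orientations. The library notions
  \<^const>\<open>connected\<close>, \<^const>\<open>complete_digraph\<close> and \<^const>\<open>digraph_iso\<close> apply to such a graph through
  the embedding \<^const>\<open>with_proj\<close>.
\<close>

definition strong_prod :: "'a pair_pre_digraph \<Rightarrow> 'b pair_pre_digraph \<Rightarrow> ('a \<times> 'b) pair_pre_digraph"
    (infixl \<open>\<boxtimes>\<close> 70) where
  "G \<boxtimes> H = \<lparr> pverts = pverts G \<times> pverts H,
     parcs = {((x, y), (x', y')) | x y x' y'.
       (x, y) \<in> pverts G \<times> pverts H \<and> (x', y') \<in> pverts G \<times> pverts H \<and>
       ((x, x') \<in> parcs G \<and> y = y' \<or>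
        x = x' \<and> (y, y') \<in> parcs H \<or>
        (x, x') \<in> parcs G \<and> (y, y') \<in> parcs H)} \<rparr>"

definition lex_prod_graph :: "'a pair_pre_digraph \<Rightarrow> 'b pair_pre_digraph \<Rightarrow> ('a \<times> 'b) pair_pre_digraph"
    (infixl \<open>\<circ>\<^sub>L\<close> 70) where
  "G \<circ>\<^sub>L H = \<lparr> pverts = pverts G \<times> pverts H,
     parcs = {((x, y), (x', y')) | x y x' y'.
       (x, y) \<in> pverts G \<times> pverts H \<and> (x', y') \<in> pverts G \<times> pverts H \<and>
       ((x, x') \<in> parcs G \<or>
        x = x' \<and> (y, y') \<in> parcs H)} \<rparr>"

lemma pair_graph_iff:
  "pair_graph G \<longleftrightarrow> finite (pverts G) \<and> parcs G \<subseteq> pverts G \<times> pverts G \<and> sym (parcs G) \<and> irrefl (parcs G)"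
proof
  assume "pair_graph G"
  then interpret pair_graph G .
  show "finite (pverts G) \<and> parcs G \<subseteq> pverts G \<times> pverts G \<and> sym (parcs G) \<and> irrefl (parcs G)"
    using pair_finite_verts wellformed' pair_sym_arcs no_loops'
    unfolding symmetric_def irrefl_def with_proj_simps by (intro conjI subrelI allI notI) blast+
next
  assume *: "finite (pverts G) \<and> parcs G \<subseteq> pverts G \<times> pverts G \<and> sym (parcs G) \<and> irrefl (parcs G)"
  then have "finite (parcs G)" by (meson finite_SigmaI finite_subset)
  with * show "pair_graph G"
    by unfold_locales (auto simp: symmetric_def irrefl_def)
qed

lemma pair_graph_strong_prod: "pair_graph G \<Longrightarrow> pair_graph H \<Longrightarrow> pair_graph (G \<boxtimes> H)"
  unfolding pair_graph_iff strong_prod_def by (auto simp: sym_def irrefl_def)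

lemma pair_graph_lex_prod: "pair_graph G \<Longrightarrow> pair_graph H \<Longrightarrow> pair_graph (G \<circ>\<^sub>L H)"
  unfolding pair_graph_iff lex_prod_graph_def by (auto simp: sym_def irrefl_def)

text \<open>
  On these graphs \<^const>\<open>digraph_iso\<close>, which also carries an arc map, is the usual notion: a bijection
  of the vertex sets preserving adjacency and non-adjacency.
\<close>

lemma digraph_iso_with_proj_iff:
  assumes "pair_graph G" "pair_graph H"
  shows "digraph_iso (with_proj G) (with_proj H) \<longleftrightarrow>
    (\<exists>f. bij_betw f (pverts G) (pverts H) \<and>
      (\<forall>u\<in>pverts G. \<forall>v\<in>pverts G. (u, v) \<in> parcs G \<longleftrightarrow> (f u, f v) \<in> parcs H))"
    (is "?L \<longleftrightarrow> ?R")
proof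
  interpret G: pair_graph G by fact
  interpret H: pair_graph H by fact
  {
    assume ?L
    then obtain h where h: "pre_digraph.digraph_isomorphism (with_proj G) h"
      "with_proj H = app_iso h (with_proj G)"
      by (auto simp: digraph_iso_def)
    define f where "f = iso_verts h"
    have V: "pverts H = f ` pverts G" and A: "parcs H = iso_arcs h ` parcs G"
      and T: "iso_tail h = fst" "iso_head h = snd"
      using h(2) by (auto simp: with_proj_def app_iso_def f_def)
    have inj: "inj_on f (pverts G)"
      using h(1) by (auto simp: pre_digraph.digraph_isomorphism_def f_def)
    have arc: "iso_arcs h a = (f (fst a), f (snd a))" if "a \<in> parcs G" for a
      using h(1) that T by (auto simp: pre_digraph.digraph_isomorphism_def f_def prod_eq_iff)
    have A': "parcs H = (\<lambda>a. (f (fst a), f (snd a))) ` parcs G"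
      unfolding A by (intro image_cong) (auto simp: arc)
    have "(u, v) \<in> parcs G \<longleftrightarrow> (f u, f v) \<in> parcs H" if "u \<in> pverts G" "v \<in> pverts G" for u v
    proof
      assume "(f u, f v) \<in> parcs H"
      then obtain x y where xy: "(x, y) \<in> parcs G" "f u = f x" "f v = f y"
        unfolding A' by auto
      then have "u = x" "v = y"
        using that inj G.wellformed' by (auto dest: inj_onD)
      with xy show "(u, v) \<in> parcs G" by simp
    qed (force simp: A')
    with inj V show ?R by (auto simp: bij_betw_def)
  next
    assume ?R
    then obtain f where f: "bij_betw f (pverts G) (pverts H)"
      and e: "\<And>u v. u \<in> pverts G \<Longrightarrow> v \<in> pverts G \<Longrightarrow> (u, v) \<in> parcs G \<longleftrightarrow> (f u, f v) \<in> parcs H"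
      by blast
    define h where "h = \<lparr> iso_verts = f, iso_arcs = map_prod f f,
      iso_head = (snd :: 'b \<times> 'b \<Rightarrow> 'b), iso_tail = (fst :: 'b \<times> 'b \<Rightarrow> 'b) \<rparr>"
    have inj: "inj_on f (pverts G)" and V: "pverts H = f ` pverts G"
      using f by (auto simp: bij_betw_def)
    have "inj_on (map_prod f f) (parcs G)"
      by (rule inj_on_subset[OF map_prod_inj_on[OF inj inj]]) (auto dest: G.wellformed')
    then have 1: "pre_digraph.digraph_isomorphism (with_proj G) h"
      using inj G.wf_digraph
      by (auto simp: pre_digraph.digraph_isomorphism_def h_def)
    have "parcs H = map_prod f f ` parcs G"
    proof (intro set_eqI iffI)
      fix a assume a: "a \<in> parcs H"
      then have "fst a \<in> f ` pverts G" "snd a \<in> f ` pverts G"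
        using H.arc_fst_in_verts H.arc_snd_in_verts V by blast+
      then obtain u v where uv: "u \<in> pverts G" "v \<in> pverts G" "a = (f u, f v)"
        by (metis imageE prod.collapse)
      then have "(u, v) \<in> parcs G" using a e by simp
      then show "a \<in> map_prod f f ` parcs G" unfolding uv(3) by (rule rev_image_eqI) simp
    next
      fix a assume "a \<in> map_prod f f ` parcs G"
      then obtain u v where uv: "(u, v) \<in> parcs G" "a = (f u, f v)" by auto
      then show "a \<in> parcs H" using e[of u v] G.wellformed'[of u v] by blast
    qed
    then have "with_proj H = app_iso h (with_proj G)"
      by (simp add: with_proj_def app_iso_def h_def V)
    with 1 show ?L by (auto simp: digraph_iso_def)
  }
qed

end

theory Submission
  imports Defs "Graph_Theory.Euler"
begin

text \<open>
  Both products live on the same vertex set, and every arc of the strong product is an arc of the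
  lexicographic one. An isomorphism forces the two finite arc sets to have the same cardinality,
  hence to coincide. Given an edge \<open>x x'\<close> of \<open>G\<close> and distinct vertices \<open>y\<close>, \<open>y'\<close> of \<open>H\<close>, the pair
  \<open>(x, y)\<close>, \<open>(x', y')\<close> is adjacent in the lexicographic product, so it is adjacent in the strong
  product, which says that \<open>y y'\<close> is an edge of \<open>H\<close>.
\<close>

lemma pverts_strong_prod [simp]: "pverts (G \<boxtimes> H) = pverts G \<times> pverts H"
  by (simp add: strong_prod_def)

lemma pverts_lex_prod_graph [simp]: "pverts (G \<circ>\<^sub>L H) = pverts G \<times> pverts H"
  by (simp add: lex_prod_graph_def)

lemma parcs_strong_prod_iff:
  "((x, y), (x', y')) \<in> parcs (G \<boxtimes> H) \<longleftrightarrow>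
    x \<in> pverts G \<and> y \<in> pverts H \<and> x' \<in> pverts G \<and> y' \<in> pverts H \<and>
    ((x, x') \<in> parcs G \<and> y = y' \<or> x = x' \<and> (y, y') \<in> parcs H \<or>
     (x, x') \<in> parcs G \<and> (y, y') \<in> parcs H)"
  by (auto simp: strong_prod_def)

lemma parcs_lex_prod_graph_iff:
  "((x, y), (x', y')) \<in> parcs (G \<circ>\<^sub>L H) \<longleftrightarrow>
    x \<in> pverts G \<and> y \<in> pverts H \<and> x' \<in> pverts G \<and> y' \<in> pverts H \<and>
    ((x, x') \<in> parcs G \<or> x = x' \<and> (y, y') \<in> parcs H)"
  by (auto simp: lex_prod_graph_def)

lemma parcs_strong_prod_subset_lex_prod_graph: "parcs (G \<boxtimes> H) \<subseteq> parcs (G \<circ>\<^sub>L H)"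
  by (auto simp: parcs_strong_prod_iff parcs_lex_prod_graph_iff)

text \<open>The arc map of an isomorphism is injective on \<open>arcs G\<close> with image
  \<open>arcs H\<close>.\<close>

lemma card_arcs_digraph_iso:
  assumes "digraph_iso G H"
  shows "card (arcs G) = card (arcs H)"
  using assms unfolding digraph_iso_def
  by (auto simp: pre_digraph.digraph_isomorphism_inj_on_arcs card_image)

text \<open>A connected graph with no arcs has a single vertex, which the bound on the cardinality
  rules out.\<close>

lemma connected_obtains_parc:
  assumes "pair_graph G" "connected (with_proj G)" "card (pverts G) \<ge> 2"
  obtains x x' where "(x, x') \<in> parcs G" "x \<in> pverts G" "x' \<in> pverts G"
proof -
  interpret pair_graph G by fact
  have "parcs G \<noteq> {}"
  proof
    assume "parcs G = {}"
    moreover have "pverts G \<noteq> {}" using assms(3) by auto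
    ultimately obtain v where "pverts G = {v}"
      using connected_arcs_empty[OF assms(2)] by auto
    then show False using assms(3) by simp
  qed
  then obtain x x' where "(x, x') \<in> parcs G" by auto
  then show ?thesis using that wellformed' by blast
qed

text \<open>In a complete \<open>H\<close>, any vertices \<open>y\<close> and \<open>y'\<close> are
  equal or adjacent, so an arc \<open>(x, x')\<close> of \<open>G\<close> already gives adjacency in
  the strong product.\<close>

lemma strong_prod_eq_lex_prod_graph_if_complete:
  assumes "complete_digraph n (with_proj H)"
  shows "G \<boxtimes> H = G \<circ>\<^sub>L H"
proof -
  have "parcs (G \<boxtimes> H) = parcs (G \<circ>\<^sub>L H)"
    using assms
    by (auto simp: complete_digraph_pair_def parcs_strong_prod_iff parcs_lex_prod_graph_iff)
  then show ?thesis by (simp add: strong_prod_def lex_prod_graph_def)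
qed

lemma complete_if_parcs_strong_prod_eq_lex_prod_graph:
  assumes "pair_graph H" "(x, x') \<in> parcs G" "x \<in> pverts G" "x' \<in> pverts G"
    and eq: "parcs (G \<boxtimes> H) = parcs (G \<circ>\<^sub>L H)"
  shows "complete_digraph (card (pverts H)) (with_proj H)"
proof -
  interpret H: pair_graph H by fact
  have "parcs H = {(y, y'). (y, y') \<in> pverts H \<times> pverts H \<and> y \<noteq> y'}"
  proof (intro equalityI subrelI)
    fix y y'
    assume "(y, y') \<in> parcs H"
    then show "(y, y') \<in> {(y, y'). (y, y') \<in> pverts H \<times> pverts H \<and> y \<noteq> y'}"
      by (blast dest: H.wellformed' H.no_loops')
  next
    fix y y'
    assume "(y, y') \<in> {(y, y'). (y, y') \<in> pverts H \<times> pverts H \<and> y \<noteq> y'}"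
    then have y: "y \<in> pverts H" "y' \<in> pverts H" "y \<noteq> y'" by auto
    then have "((x, y), (x', y')) \<in> parcs (G \<boxtimes> H)"
      using assms by (simp add: parcs_lex_prod_graph_iff)
    \<comment> \<open>Since \<open>y \<noteq> y'\<close>, the first way of being adjacent in the
      strong product is impossible; the other two both contain
      \<open>(y, y') \<in> parcs H\<close>.\<close>
    then show "(y, y') \<in> parcs H" unfolding parcs_strong_prod_iff using y(3) by blast
  qed
  then show ?thesis by (simp add: complete_digraph_pair_def)
qed

theorem theorem3p8:
  fixes G :: "'a pair_pre_digraph" and H :: "'b pair_pre_digraph"
  assumes "pair_graph G" and "pair_graph H"
    and "connected (with_proj G)" and "connected (with_proj H)"
    and "card (pverts G) \<ge> 2" and "card (pverts H) \<ge> 2"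
  shows "digraph_iso (with_proj (G \<boxtimes> H)) (with_proj (G \<circ>\<^sub>L H)) \<longleftrightarrow>
    complete_digraph (card (pverts H)) (with_proj H)"
proof
  assume "digraph_iso (with_proj (G \<boxtimes> H)) (with_proj (G \<circ>\<^sub>L H))"
  from card_arcs_digraph_iso[OF this]
  have card_eq: "card (parcs (G \<boxtimes> H)) = card (parcs (G \<circ>\<^sub>L H))" by simp
  \<comment> \<open>This makes \<open>parcs (G \<circ>\<^sub>L H)\<close> finite, so that inclusion
    together with equal cardinality yields equality.\<close>
  interpret L: pair_graph "G \<circ>\<^sub>L H"
    using assms by (intro pair_graph_lex_prod)
  from card_eq have "parcs (G \<boxtimes> H) = parcs (G \<circ>\<^sub>L H)"
    by (intro card_subset_eq parcs_strong_prod_subset_lex_prod_graph) simp_all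
  moreover obtain x x' where "(x, x') \<in> parcs G" "x \<in> pverts G" "x' \<in> pverts G"
    using assms by (elim connected_obtains_parc)
  ultimately show "complete_digraph (card (pverts H)) (with_proj H)"
    using assms(2) by (intro complete_if_parcs_strong_prod_eq_lex_prod_graph)
next
  assume "complete_digraph (card (pverts H)) (with_proj H)"
  then have "G \<boxtimes> H = G \<circ>\<^sub>L H" by (rule strong_prod_eq_lex_prod_graph_if_complete)
  moreover have "pair_graph (G \<circ>\<^sub>L H)" using assms by (intro pair_graph_lex_prod)
  \<comment> \<open>The two products are the same graph, so the identity serves as the vertex
    bijection.\<close>
  ultimately show "digraph_iso (with_proj (G \<boxtimes> H)) (with_proj (G \<circ>\<^sub>L H))"
    by (simp add: digraph_iso_with_proj_iff) (metis bij_betw_id id_apply)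
qed

end
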